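(* Let $N$ be a timelike ruled surface of type $N_-$ in $\mathbb{R}_1^3$ with timelike striction curve $\vec c$ and angle function $\theta$, and let $N^\gamma$ be any $\gamma$-transversal surface of $N$, with ruling $\vec q_\gamma=\mu\vec q+\eta\vec a$. Then the striction curve $\vec c_\gamma$ of $N^\gamma$ coincides with the striction curve $\vec c$ of $N$ if and only if $\gamma$ is constant or $$\tanh\theta=\frac{\eta}{\mu}$$ holds.
   Context: $\mathbb{R}_1^3$ is Minkowski 3-space with metric $\langle\cdot,\cdot\rangle=-dx_1^2+dx_2^2+dx_3^2$. A nonzero vector $\vec v$ is timelike if $\langle\vec v,\vec v\rangle<0$, null if $\langle\vec v,\vec v\rangle=0$, spacelike if $\langle\vec v,\vec v\rangle>0$. Setting. All functions are smooth on an open interval $I$, and equations between functions are identities on $I$. A timelike ruled surface of type $N_-$ with timelike striction curve is $\vec r(s,v)=\vec c(s)+v\vec q(s)$, with ruling direction $\vec q$ unit timelike, where $\vec c$ is its striction curve, a timelike curve parametrized by arc length $s$. It has a Frenet frame $\{\vec q,\vec h,\vec a\}$ of mutually orthogonal vectors, $\langle\vec q,\vec q\rangle=-1$, $\langle\vec h,\vec h\rangle=\langle\vec a,\vec a\rangle=1$ ($\vec h$ is the central normal, i.e. the surface normal along $\vec c$; $\vec a$ the central tangent), with $\vec q\,'=k_1\vec h$, $\vec h'=k_1\vec q+k_2\vec a$, $\vec a'=-k_2\vec h$ (prime is $d/ds$) for functions $k_1,k_2$. Standing assumption: the frame vectors and their derivatives are non-null, and $\vec q\,'\neq0$ (i.e.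 $k_1\neq0$). The unit tangent of $\vec c$ is $\vec c\,'=\vec t=\cosh\theta\,\vec q+\sinh\theta\,\vec a$ for a real function $\theta$ (the hyperbolic angle between $\vec t$ and $\vec q$). $\gamma$-transversal surface. For a function $\gamma:I\to\mathbb{R}$, $N^\gamma$ is the ruled surface $\vec r_\gamma(s,v)=\vec c(s)+v\vec q_\gamma(s)$ with $\vec q_\gamma=\mu\vec q+\eta\vec a$, where $(\mu,\eta)=(\cosh\gamma,\sinh\gamma)$ if $\vec q_\gamma$ is timelike and $(\mu,\eta)=(\sinh\gamma,\cosh\gamma)$ if $\vec q_\gamma$ is spacelike; it is assumed that $\mu\ne0$ and $\eta\neq0$. Its striction curve is $\vec c_\gamma=\vec c+v_\gamma\vec q_\gamma$ with strictional distance $v_\gamma=-\langle\vec c\,',\vec q_\gamma'\rangle/\langle\vec q_\gamma',\vec q_\gamma'\rangle$ (this formula presupposes a nonzero denominator); it coincides with $\vec c$ if $v_\gamma=0$.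
   Formalization: For smooth data the "only if" fails when γ is constant on one part of I and tanh θ = η/μ on another; so it is proved as γ' = 0 or tanh θ = η/μ at each point, equivalently γ constant or tanh θ = η/μ on some subinterval of every open subinterval; the "if" part is unchanged. *)

theory Defs
  imports "HOL-Analysis.Analysis"
begin

section \<open>Minkowski 3-space\<close>

definition mink :: "real^3 \<Rightarrow> real^3 \<Rightarrow> real"
  where "mink u v = - (u $ 1 * v $ 1) + u $ 2 * v $ 2 + u $ 3 * v $ 3"

text \<open>All three causal characters concern nonzero vectors only, so the zero vector is not null.\<close>

definition timelike :: "real^3 \<Rightarrow> bool"
  where "timelike u \<longleftrightarrow> u \<noteq> 0 \<and> mink u u < 0"

definition null_vec :: "real^3 \<Rightarrow> bool"
  where "null_vec u \<longleftrightarrow> u \<noteq> 0 \<and> mink u u = 0"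

definition spacelike :: "real^3 \<Rightarrow> bool"
  where "spacelike u \<longleftrightarrow> u \<noteq> 0 \<and> mink u u > 0"

section \<open>Smooth functions on an open interval\<close>

definition open_interval :: "real set \<Rightarrow> bool"
  where "open_interval I \<longleftrightarrow> open I \<and> is_interval I \<and> I \<noteq> {}"

text \<open>\<open>F n\<close> is the \<open>n\<close>-th derivative of \<open>f\<close> on the open set \<open>I\<close>.\<close>

definition smooth_on :: "real set \<Rightarrow> (real \<Rightarrow> 'a::real_normed_vector) \<Rightarrow> bool"
  where "smooth_on I f \<longleftrightarrow>
    (\<exists>F. F 0 = f \<and> (\<forall>n. \<forall>s\<in>I. (F n has_vector_derivative F (Suc n) s) (at s)))"

section \<open>Ruled surfaces and their striction curves\<close>

text \<open>
  A ruled surface \<open>r(s,v) = c(s) + v q(s)\<close> is given by its base curve \<open>c\<close> and its ruling \<open>q\<close>.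
  The formula for the strictional distance is meaningful only where \<open>mink q' q' \<noteq> 0\<close>.
\<close>

definition strictional_distance :: "(real \<Rightarrow> real^3) \<Rightarrow> (real \<Rightarrow> real^3) \<Rightarrow> real \<Rightarrow> real"
  where "strictional_distance c q s =
    - mink (vector_derivative c (at s)) (vector_derivative q (at s))
      / mink (vector_derivative q (at s)) (vector_derivative q (at s))"

definition striction_curve :: "(real \<Rightarrow> real^3) \<Rightarrow> (real \<Rightarrow> real^3) \<Rightarrow> real \<Rightarrow> real^3"
  where "striction_curve c q s = c s + strictional_distance c q s *\<^sub>R q s"

section \<open>Timelike ruled surfaces of type \<open>N\<^sub>-\<close> with timelike striction curve\<close>

text \<open>
  The surface \<open>c(s) + v q(s)\<close> is timelike wherever it is regular, because its tangent planes
  contain the timelike vector \<open>q\<close>. The frame conditions and \<open>c' = cosh \<theta> q + sinh \<theta> a\<close> make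
  \<open>h\<close> orthogonal to \<open>q\<close> and \<open>c'\<close>, that is, normal to the surface along \<open>c\<close>.
\<close>

locale timelike_ruled_surface =
  fixes I :: "real set"
    and c q h a :: "real \<Rightarrow> real^3"
    and k1 k2 \<theta> :: "real \<Rightarrow> real"
  assumes interval: "open_interval I"
    and smooth_vectors: "smooth_on I c" "smooth_on I q" "smooth_on I h" "smooth_on I a"
    and smooth_scalars: "smooth_on I k1" "smooth_on I k2" "smooth_on I \<theta>"
    and base_is_striction: "\<And>s. s \<in> I \<Longrightarrow> striction_curve c q s = c s"
    and arc_length: "\<And>s. s \<in> I \<Longrightarrow>
      mink (vector_derivative c (at s)) (vector_derivative c (at s)) = -1"
    and frame_norms: "\<And>s. s \<in> I \<Longrightarrow> mink (q s) (q s) = -1"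
      "\<And>s. s \<in> I \<Longrightarrow> mink (h s) (h s) = 1"
      "\<And>s. s \<in> I \<Longrightarrow> mink (a s) (a s) = 1"
    and frame_orthogonal: "\<And>s. s \<in> I \<Longrightarrow> mink (q s) (h s) = 0"
      "\<And>s. s \<in> I \<Longrightarrow> mink (q s) (a s) = 0"
      "\<And>s. s \<in> I \<Longrightarrow> mink (h s) (a s) = 0"
    and frenet: "\<And>s. s \<in> I \<Longrightarrow> vector_derivative q (at s) = k1 s *\<^sub>R h s"
      "\<And>s. s \<in> I \<Longrightarrow> vector_derivative h (at s) = k1 s *\<^sub>R q s + k2 s *\<^sub>R a s"
      "\<And>s. s \<in> I \<Longrightarrow> vector_derivative a (at s) = - k2 s *\<^sub>R h s"
    and frame_derivs_non_null: "\<And>s. s \<in> I \<Longrightarrow> \<not> null_vec (vector_derivative q (at s))"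
      "\<And>s. s \<in> I \<Longrightarrow> \<not> null_vec (vector_derivative h (at s))"
      "\<And>s. s \<in> I \<Longrightarrow> \<not> null_vec (vector_derivative a (at s))"
    and q_deriv_nonzero: "\<And>s. s \<in> I \<Longrightarrow> vector_derivative q (at s) \<noteq> 0"
    and tangent: "\<And>s. s \<in> I \<Longrightarrow>
      vector_derivative c (at s) = cosh (\<theta> s) *\<^sub>R q s + sinh (\<theta> s) *\<^sub>R a s"

section \<open>Transversal surfaces\<close>

definition transversal_ruling ::
    "(real \<Rightarrow> real^3) \<Rightarrow> (real \<Rightarrow> real^3) \<Rightarrow> (real \<Rightarrow> real) \<Rightarrow> (real \<Rightarrow> real) \<Rightarrow> real \<Rightarrow> real^3"
  where "transversal_ruling q a \<mu> \<eta> s = \<mu> s *\<^sub>R q s + \<eta> s *\<^sub>R a s"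

locale transversal_surface = timelike_ruled_surface I c q h a k1 k2 \<theta>
  for I :: "real set"
    and c q h a :: "real \<Rightarrow> real^3"
    and k1 k2 \<theta> :: "real \<Rightarrow> real" +
  fixes \<gamma> \<mu> \<eta> :: "real \<Rightarrow> real"
  assumes smooth_angle: "smooth_on I \<gamma>"
    and causal_type:
      "(\<forall>s\<in>I. timelike (transversal_ruling q a \<mu> \<eta> s) \<and>
          \<mu> s = cosh (\<gamma> s) \<and> \<eta> s = sinh (\<gamma> s)) \<or>
       (\<forall>s\<in>I. spacelike (transversal_ruling q a \<mu> \<eta> s) \<and>
          \<mu> s = sinh (\<gamma> s) \<and> \<eta> s = cosh (\<gamma> s))"
    and coefficients_nonzero: "\<And>s. s \<in> I \<Longrightarrow> \<mu> s \<noteq> 0" "\<And>s. s \<in> I \<Longrightarrow> \<eta> s \<noteq> 0"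
    and strictional_distance_defined: "\<And>s. s \<in> I \<Longrightarrow>
      mink (vector_derivative (transversal_ruling q a \<mu> \<eta>) (at s))
           (vector_derivative (transversal_ruling q a \<mu> \<eta>) (at s)) \<noteq> 0"

end

theory Submission
  imports Defs
begin

text \<open>
  In both causal cases \<open>\<mu>' = \<gamma>' \<eta>\<close> and \<open>\<eta>' = \<gamma>' \<mu>\<close>, so by the Frenet formulas
  \<open>\<langle>c', q\<^sub>\<gamma>'\<rangle> = \<gamma>' (\<mu> sinh \<theta> - \<eta> cosh \<theta>)\<close>. Hence \<open>v\<^sub>\<gamma>\<close> vanishes at a point iff
  \<open>\<gamma>' = 0\<close> or \<open>tanh \<theta> = \<eta> / \<mu>\<close> there. By continuity of the product, vanishing everywhere is the same
  as vanishing on a dense open set, on which one of the two alternatives holds locally.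
\<close>

section \<open>Bilinearity of the Minkowski form and calculus on open intervals\<close>

lemma mink_add_right: "mink u (v + w) = mink u v + mink u w"
  and mink_diff_right: "mink u (v - w) = mink u v - mink u w"
  and mink_add_left: "mink (u + v) w = mink u w + mink v w"
  and mink_scaleR_right: "mink u (x *\<^sub>R v) = x * mink u v"
  and mink_scaleR_left: "mink (x *\<^sub>R u) v = x * mink u v"
  and mink_commute: "mink u v = mink v u"
  by (simp_all add: mink_def algebra_simps)

lemma smooth_on_has_vector_derivative:
  assumes "smooth_on I f" "s \<in> I"
  shows "(f has_vector_derivative vector_derivative f (at s)) (at s)"
  using assms unfolding smooth_on_def
  by (metis vector_derivative_at)

lemma smooth_on_has_deriv:
  fixes f :: "real \<Rightarrow> real"
  assumes "smooth_on I f" "s \<in> I"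
  shows "(f has_real_derivative deriv f s) (at s)"
  using smooth_on_has_vector_derivative[OF assms]
  by (metis DERIV_imp_deriv has_real_derivative_iff_has_vector_derivative)

lemma smooth_on_imp_continuous_on:
  assumes "smooth_on I f"
  shows "continuous_on I f"
  by (meson assms continuous_at_imp_continuous_on has_vector_derivative_continuous
      smooth_on_has_vector_derivative)

text \<open>The first member \<open>F 1\<close> of a witnessing derivative sequence equals
  \<open>deriv f\<close> on \<open>I\<close>, and it is itself differentiable there, hence
  continuous.\<close>

lemma smooth_on_continuous_on_deriv:
  fixes f :: "real \<Rightarrow> real"
  assumes "smooth_on I f"
  shows "continuous_on I (deriv f)"
proof -
  obtain F where F: "F 0 = f"
    "\<And>n s. s \<in> I \<Longrightarrow> (F n has_vector_derivative F (Suc n) s) (at s)"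
    using assms unfolding smooth_on_def by blast
  have "deriv f s = F 1 s" if "s \<in> I" for s
    using F(2)[OF that, of 0] F(1)
    by (simp add: DERIV_imp_deriv has_real_derivative_iff_has_vector_derivative)
  moreover have "continuous_on I (F 1)"
    using F(2)[of _ 1] by (meson continuous_at_imp_continuous_on has_vector_derivative_continuous)
  ultimately show ?thesis
    by (metis continuous_on_cong)
qed

text \<open>Nothing is known about \<open>f\<close> outside \<open>K\<close>; openness makes the
  two-sided derivative at \<open>s\<close> depend on values in \<open>K\<close> only.\<close>

lemma constant_on_imp_deriv_eq_0:
  fixes f :: "real \<Rightarrow> real"
  assumes "f constant_on K" "open K" "s \<in> K"
  shows "deriv f s = 0"
proof -
  obtain y where "\<And>x. x \<in> K \<Longrightarrow> f x = y"
    using assms(1) by (auto simp: constant_on_def)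
  then have "(f has_real_derivative 0) (at s)"
    using has_field_derivative_transform_within_open[OF DERIV_const assms(2,3), of y f] by simp
  then show ?thesis
    by (rule DERIV_imp_deriv)
qed

text \<open>This is the passage from a point to an interval, needed in both directions of the local
  characterization.\<close>

lemma open_interval_in_nonzero_set:
  fixes f :: "real \<Rightarrow> real"
  assumes "open I" "continuous_on I f" "s \<in> I" "f s \<noteq> 0"
  obtains J where "open_interval J" "J \<subseteq> I" "s \<in> J" "\<And>t. t \<in> J \<Longrightarrow> f t \<noteq> 0"
proof -
  have "open {t \<in> I. f t \<noteq> 0}"
    using continuous_open_preimage[OF assms(2,1), of "- {0}"]
    by (simp add: vimage_def Int_def open_Compl)
  then obtain e where e: "e > 0" "ball s e \<subseteq> {t \<in> I. f t \<noteq> 0}"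
    using assms(3,4) by (metis (mono_tags, lifting) mem_Collect_eq open_contains_ball)
  have "open_interval (ball s e)"
    using e(1) by (auto simp: open_interval_def is_interval_convex_1)
  then show thesis
    using that[of "ball s e"] e by (auto simp: subset_eq)
qed

section \<open>Strictional distance of the transversal surface\<close>

context transversal_surface
begin

lemma open_domain: "open I"
  using interval by (simp add: open_interval_def)

text \<open>\<open>cosh\<close> and \<open>sinh\<close> are derivatives of each other without a
  sign, so swapping them between the two causal types leaves these formulas unchanged. No later
  derivative computation has to split cases.\<close>

lemma coefficients_have_derivative:
  assumes "s \<in> I"
  shows "(\<mu> has_real_derivative deriv \<gamma> s * \<eta> s) (at s)"
    and "(\<eta> has_real_derivative deriv \<gamma> s * \<mu> s) (at s)"
proof -
  note g = smooth_on_has_deriv[OF smooth_angle assms]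
  have ch: "((\<lambda>s. cosh (\<gamma> s)) has_real_derivative deriv \<gamma> s * sinh (\<gamma> s)) (at s)"
    and sh: "((\<lambda>s. sinh (\<gamma> s)) has_real_derivative deriv \<gamma> s * cosh (\<gamma> s)) (at s)"
    by (auto intro!: derivative_eq_intros g)
  \<comment> \<open>The coefficients agree with the hyperbolic functions on \<open>I\<close> only,
    so the derivatives are transferred along the open set \<open>I\<close>.\<close>
  note tr = has_field_derivative_transform_within_open[OF _ open_domain assms]
  show "(\<mu> has_real_derivative deriv \<gamma> s * \<eta> s) (at s)"
    using causal_type tr[OF ch] tr[OF sh] assms by (elim disjE) simp_all
  show "(\<eta> has_real_derivative deriv \<gamma> s * \<mu> s) (at s)"
    using causal_type tr[OF ch] tr[OF sh] assms by (elim disjE) simp_all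
qed

lemma vector_derivative_transversal_ruling:
  assumes "s \<in> I"
  shows "vector_derivative (transversal_ruling q a \<mu> \<eta>) (at s) =
    (deriv \<gamma> s * \<eta> s) *\<^sub>R q s + (\<mu> s * k1 s - \<eta> s * k2 s) *\<^sub>R h s + (deriv \<gamma> s * \<mu> s) *\<^sub>R a s"
proof -
  have "((\<lambda>s. \<mu> s *\<^sub>R q s + \<eta> s *\<^sub>R a s) has_vector_derivative
      (\<mu> s *\<^sub>R (k1 s *\<^sub>R h s) + (deriv \<gamma> s * \<eta> s) *\<^sub>R q s) +
      (\<eta> s *\<^sub>R (- k2 s *\<^sub>R h s) + (deriv \<gamma> s * \<mu> s) *\<^sub>R a s)) (at s)"
    using coefficients_have_derivative[OF assms]
      smooth_on_has_vector_derivative[OF smooth_vectors(2) assms]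
      smooth_on_has_vector_derivative[OF smooth_vectors(4) assms]
    unfolding frenet(1)[OF assms] frenet(3)[OF assms]
    by (intro has_vector_derivative_add has_vector_derivative_scaleR)
  then show ?thesis
    by (simp add: transversal_ruling_def[abs_def] vector_derivative_at algebra_simps)
qed

text \<open>The tangent of \<open>c\<close> has no \<open>h\<close> component, so \<open>k1\<close>
  and \<open>k2\<close> drop out; the minus sign comes from the timelike \<open>q\<close>.\<close>

lemma mink_tangent_transversal_ruling:
  assumes "s \<in> I"
  shows "mink (vector_derivative c (at s)) (vector_derivative (transversal_ruling q a \<mu> \<eta>) (at s)) =
    deriv \<gamma> s * (\<mu> s * sinh (\<theta> s) - \<eta> s * cosh (\<theta> s))"
  using frame_norms[OF assms] frame_orthogonal[OF assms] mink_commute[of "a s" "q s"] mink_commute[of "a s" "h s"]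
  by (simp add: tangent[OF assms] vector_derivative_transversal_ruling[OF assms]
      mink_add_left mink_add_right mink_diff_right mink_scaleR_left mink_scaleR_right algebra_simps)

lemma transversal_ruling_nonzero: "s \<in> I \<Longrightarrow> transversal_ruling q a \<mu> \<eta> s \<noteq> 0"
  using causal_type by (auto simp: timelike_def spacelike_def)

text \<open>The curves meet at \<open>s\<close> iff the strictional distance times the ruling is
  zero. The ruling is nonzero, so the distance is zero; its denominator is nonzero, so this means a
  zero numerator and not the convention \<open>x / 0 = 0\<close>.\<close>

lemma striction_curve_transversal_iff_product:
  assumes "s \<in> I"
  shows "striction_curve c (transversal_ruling q a \<mu> \<eta>) s = c s \<longleftrightarrow>
    deriv \<gamma> s * (\<mu> s * sinh (\<theta> s) - \<eta> s * cosh (\<theta> s)) = 0"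
  using transversal_ruling_nonzero[OF assms] strictional_distance_defined[OF assms]
  by (simp add: striction_curve_def strictional_distance_def
      mink_tangent_transversal_ruling[OF assms])

text \<open>Both denominators, \<open>cosh (\<theta> s)\<close> and \<open>\<mu> s\<close>, are
  nonzero and can be cleared.\<close>

lemma tanh_eq_ratio_iff:
  assumes "s \<in> I"
  shows "tanh (\<theta> s) = \<eta> s / \<mu> s \<longleftrightarrow> \<mu> s * sinh (\<theta> s) - \<eta> s * cosh (\<theta> s) = 0"
  using coefficients_nonzero(1)[OF assms]
  by (simp add: tanh_def frac_eq_eq mult.commute)

lemma striction_curve_transversal_iff:
  assumes "s \<in> I"
  shows "striction_curve c (transversal_ruling q a \<mu> \<eta>) s = c s \<longleftrightarrow>
    deriv \<gamma> s = 0 \<or> tanh (\<theta> s) = \<eta> s / \<mu> s"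
  unfolding striction_curve_transversal_iff_product[OF assms] tanh_eq_ratio_iff[OF assms] by simp

section \<open>From the pointwise alternative to the local one and back\<close>

lemma continuous_on_product:
  "continuous_on I (\<lambda>s. deriv \<gamma> s * (\<mu> s * sinh (\<theta> s) - \<eta> s * cosh (\<theta> s)))"
proof -
  have "continuous_on I \<mu>" "continuous_on I \<eta>"
    using coefficients_have_derivative by (meson DERIV_isCont continuous_at_imp_continuous_on)+
  then show ?thesis
    by (intro continuous_intros smooth_on_continuous_on_deriv smooth_angle
        smooth_on_imp_continuous_on[OF smooth_scalars(3)])
qed

text \<open>Either the derivative of \<gamma> vanishes on all of \<open>J\<close>, and
  \<open>K = J\<close> works, or it is nonzero on some subinterval, where the pointwise alternative
  leaves only the \<open>tanh\<close> equation.\<close>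

lemma striction_curve_transversal_locally:
  assumes coincide: "\<forall>s\<in>I. deriv \<gamma> s = 0 \<or> tanh (\<theta> s) = \<eta> s / \<mu> s"
    and J: "open_interval J" "J \<subseteq> I"
  shows "\<exists>K. open_interval K \<and> K \<subseteq> J \<and> (\<gamma> constant_on K \<or> (\<forall>s\<in>K. tanh (\<theta> s) = \<eta> s / \<mu> s))"
proof (cases "\<forall>s\<in>J. deriv \<gamma> s = 0")
  case True
  have "(\<gamma> has_real_derivative 0) (at s within J)" if "s \<in> J" for s
    using smooth_on_has_deriv[OF smooth_angle, of s] J(2) True that
    by (auto intro: has_field_derivative_at_within)
  then have "\<gamma> constant_on J"
    using J(1) has_field_derivative_zero_constant[of J \<gamma>]
    by (auto simp: open_interval_def is_interval_convex_1 constant_on_def)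
  then show ?thesis
    using J(1) by blast
next
  case False
  then obtain s where s: "s \<in> J" "deriv \<gamma> s \<noteq> 0"
    by blast
  have "open J" "continuous_on J (deriv \<gamma>)"
    using J smooth_on_continuous_on_deriv[OF smooth_angle]
    by (auto simp: open_interval_def intro: continuous_on_subset)
  then obtain K where "open_interval K" "K \<subseteq> J" "\<And>t. t \<in> K \<Longrightarrow> deriv \<gamma> t \<noteq> 0"
    using s open_interval_in_nonzero_set[of J "deriv \<gamma>" s] by blast
  then show ?thesis
    using coincide J(2) by blast
qed

text \<open>A nonzero value would persist on an interval \<open>J\<close> around \<open>s\<close>,
  but \<open>J\<close> contains an interval \<open>K\<close> on which one of the two factors
  vanishes.\<close>

lemma product_eq_0_if_locally:
  assumes dense: "\<And>J. open_interval J \<Longrightarrow> J \<subseteq> I \<Longrightarrow>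
      \<exists>K. open_interval K \<and> K \<subseteq> J \<and> (\<gamma> constant_on K \<or> (\<forall>s\<in>K. tanh (\<theta> s) = \<eta> s / \<mu> s))"
    and "s \<in> I"
  shows "deriv \<gamma> s * (\<mu> s * sinh (\<theta> s) - \<eta> s * cosh (\<theta> s)) = 0"
proof (rule ccontr)
  assume "deriv \<gamma> s * (\<mu> s * sinh (\<theta> s) - \<eta> s * cosh (\<theta> s)) \<noteq> 0"
  then obtain J where J: "open_interval J" "J \<subseteq> I" "s \<in> J"
    "\<And>t. t \<in> J \<Longrightarrow> deriv \<gamma> t * (\<mu> t * sinh (\<theta> t) - \<eta> t * cosh (\<theta> t)) \<noteq> 0"
    using open_interval_in_nonzero_set[OF open_domain continuous_on_product \<open>s \<in> I\<close>] by blast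
  obtain K where K: "open_interval K" "K \<subseteq> J"
    "\<gamma> constant_on K \<or> (\<forall>s\<in>K. tanh (\<theta> s) = \<eta> s / \<mu> s)"
    using dense[OF J(1,2)] by blast
  \<comment> \<open>Nonemptiness of \<open>K\<close> supplies the point of contradiction; openness
    lets constancy of \<gamma> on \<open>K\<close> give a zero derivative at
    \<open>t\<close>.\<close>
  then obtain t where t: "t \<in> K" "open K"
    by (auto simp: open_interval_def)
  then have "t \<in> J" "t \<in> I"
    using K(2) J(2) by auto
  with K(3) t have "deriv \<gamma> t * (\<mu> t * sinh (\<theta> t) - \<eta> t * cosh (\<theta> t)) = 0"
    using constant_on_imp_deriv_eq_0[of \<gamma> K t] tanh_eq_ratio_iff[of t] by auto
  with J(4) \<open>t \<in> J\<close> show False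
    by blast
qed

end

theorem theorem6p1:
  fixes I :: "real set"
    and c q h a :: "real \<Rightarrow> real^3"
    and k1 k2 \<theta> \<gamma> \<mu> \<eta> :: "real \<Rightarrow> real"
  assumes "transversal_surface I c q h a k1 k2 \<theta> \<gamma> \<mu> \<eta>"
  shows "((\<forall>s\<in>I. striction_curve c (transversal_ruling q a \<mu> \<eta>) s = c s) \<longleftrightarrow>
            (\<forall>s\<in>I. deriv \<gamma> s = 0 \<or> tanh (\<theta> s) = \<eta> s / \<mu> s)) \<and>
         ((\<forall>s\<in>I. striction_curve c (transversal_ruling q a \<mu> \<eta>) s = c s) \<longleftrightarrow>
            (\<forall>J. open_interval J \<and> J \<subseteq> I \<longrightarrow>
              (\<exists>K. open_interval K \<and> K \<subseteq> J \<and>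
                (\<gamma> constant_on K \<or> (\<forall>s\<in>K. tanh (\<theta> s) = \<eta> s / \<mu> s))))) \<and>
         (\<gamma> constant_on I \<or> (\<forall>s\<in>I. tanh (\<theta> s) = \<eta> s / \<mu> s) \<longrightarrow>
            (\<forall>s\<in>I. striction_curve c (transversal_ruling q a \<mu> \<eta>) s = c s))"
proof -
  interpret transversal_surface I c q h a k1 k2 \<theta> \<gamma> \<mu> \<eta>
    by (rule assms)
  have pointwise: "(\<forall>s\<in>I. striction_curve c (transversal_ruling q a \<mu> \<eta>) s = c s) \<longleftrightarrow>
      (\<forall>s\<in>I. deriv \<gamma> s = 0 \<or> tanh (\<theta> s) = \<eta> s / \<mu> s)"
    by (simp add: striction_curve_transversal_iff)
  moreover have "(\<forall>s\<in>I. striction_curve c (transversal_ruling q a \<mu> \<eta>) s = c s) \<longleftrightarrow>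
      (\<forall>J. open_interval J \<and> J \<subseteq> I \<longrightarrow> (\<exists>K. open_interval K \<and> K \<subseteq> J \<and>
        (\<gamma> constant_on K \<or> (\<forall>s\<in>K. tanh (\<theta> s) = \<eta> s / \<mu> s))))" (is "_ \<longleftrightarrow> ?dense")
  proof
    assume "\<forall>s\<in>I. striction_curve c (transversal_ruling q a \<mu> \<eta>) s = c s"
    then show ?dense
      using pointwise striction_curve_transversal_locally by simp
  next
    assume ?dense
    then show "\<forall>s\<in>I. striction_curve c (transversal_ruling q a \<mu> \<eta>) s = c s"
      using product_eq_0_if_locally striction_curve_transversal_iff_product by simp
  qed
  \<comment> \<open>Only sufficiency is asserted on all of \<open>I\<close>: a vanishing product
    does not by itself single out one factor that vanishes throughout.\<close>
  moreover have "\<gamma> constant_on I \<or> (\<forall>s\<in>I. tanh (\<theta> s) = \<eta> s / \<mu> s) \<longrightarrow>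
      (\<forall>s\<in>I. striction_curve c (transversal_ruling q a \<mu> \<eta>) s = c s)"
    using pointwise constant_on_imp_deriv_eq_0[OF _ open_domain] by blast
  ultimately show ?thesis
    by blast
qed

end
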